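(* Let $\mathcal{H}$ be a separable Hilbert space, let $\mathcal{F}=\{f_n\}_{n\in\mathbb{N}}$ be a frame for $\mathcal{H}$ with synthesis operator $T:\ell^2\to\mathcal{H}$, and let $\mathcal{N}=N(T)$. Then the following conditions are equivalent: 1. $\mathcal{F}$ is a Riesz frame. 2. $\mathcal{N}$ is $\mathcal{B}$-compatible, where $\mathcal{B}$ is the canonical orthonormal basis of $\ell^2$. 3. There exists a uniform lower frame bound for all finite linearly independent frame sequences $\mathcal{F}_J=\{f_n\}_{n\in J}$, $J\subset\mathbb{N}$ (that is, there is one constant $A>0$ that is a lower frame bound for $\mathcal{F}_J$, as a frame for its span, for every finite $J\subset\mathbb{N}$ such that $\mathcal{F}_J$ is linearly independent). 4. There exists $d>0$ such that $\gamma(TP_J)\ge d$ for every finite $J\subset\mathbb{N}$ such that $\mathcal{N}\cap\mathcal{M}_J=\{0\}$.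
   Context: A sequence (finite or countable) $\{f_n\}$ in a Hilbert space $\mathcal{K}$ is a frame for $\mathcal{K}$ if there are $A,B>0$ with $A\|f\|^2\le\sum_n|\langle f,f_n\rangle|^2\le B\|f\|^2$ for all $f\in\mathcal{K}$; such $A$, $B$ are called lower and upper frame bounds. For a frame $\mathcal{F}=\{f_n\}_{n\in\mathbb{N}}$ the synthesis operator is the bounded operator $T:\ell^2\to\mathcal{H}$ with $T(e_n)=f_n$, where $\mathcal{B}=\{e_n\}_{n\in\mathbb{N}}$ is the canonical orthonormal basis of $\ell^2$. $N(T)$ denotes the nullspace of $T$. For $I\subseteq\mathbb{N}$: $\mathcal{F}_I=\{f_n\}_{n\in I}$; $\mathcal{M}_I=\overline{\mathrm{span}}\{e_n:n\in I\}\subseteq\ell^2$; $P_I$ is the orthogonal projection of $\ell^2$ onto $\mathcal{M}_I$. $\mathcal{F}_I$ is a frame sequence if it is a frame for $\overline{\mathrm{span}}\,\mathcal{F}_I$. The frame $\mathcal{F}$ is a Riesz frame if there exist $A,B>0$ such that for every $I\subset\mathbb{N}$ the family $\mathcal{F}_I$ is a frame sequence with (not necessarily optimal) bounds $A,B$. For closed subspaces $\mathcal{M},\mathcal{N}$ of a Hilbert space put $\tilde{\mathcal{M}}=\mathcal{M}\cap(\mathcal{M}\cap\mathcal{N})^\perp$, $\tilde{\mathcal{N}}=\mathcal{N}\cap(\mathcal{M}\cap\mathcal{N})^\perp$, and $c[\mathcal{M},\mathcal{N}]=\sup\{|\langle x,y\rangle|: x\in\tilde{\mathcal{M}},\,y\in\tilde{\mathcal{N}},\,\|x\|=\|y\|=1\}$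 (with $\sup\emptyset=0$). A closed subspace $\mathcal{N}$ of $\ell^2$ is $\mathcal{B}$-compatible if $\sup_{I\subseteq\mathbb{N}}c[\mathcal{N},\mathcal{M}_I]<1$. The reduced minimum modulus of a bounded operator $T$ is $\gamma(T)=\inf\{\|Tx\|:\|x\|=1,\ x\in N(T)^\perp\}$ (with $\inf\emptyset=+\infty$). *)

theory Defs
  imports "HOL-Analysis.Analysis"
begin

section \<open>Scalars\<close>

text \<open>
  The scalar field of a Hilbert space is \<open>\<real>\<close> or \<open>\<complex>\<close>. The class below covers both at once. By the
  Gelfand--Mazur theorem (and since \<open>x * conj x = \<bar>x\<bar>\<^sup>2\<close> determines \<open>conj\<close>) it has, up to
  isometric isomorphism, no other instances.
\<close>

class real_or_complex = real_normed_field + banach +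
  fixes conj :: "'a \<Rightarrow> 'a"
  assumes conj_add: "conj (x + y) = conj x + conj y"
    and conj_mult: "conj (x * y) = conj x * conj y"
    and mult_conj_scaleR: "x * conj x = (norm x)\<^sup>2 *\<^sub>R 1"

instantiation real :: real_or_complex
begin
definition conj_real :: "real \<Rightarrow> real" where "conj_real x = x"
instance by standard (simp_all add: conj_real_def power2_eq_square)
end

instantiation complex :: real_or_complex
begin
definition conj_complex :: "complex \<Rightarrow> complex" where "conj_complex = cnj"
instance
  by standard (simp_all add: conj_complex_def complex_norm_square[symmetric] flip: of_real_def)
end

lemma mult_conj: "x * conj x = of_real ((norm (x :: 'k::real_or_complex))\<^sup>2)"
  by (simp add: mult_conj_scaleR of_real_def)

lemma conj_of_real: "conj (of_real r :: 'k::real_or_complex) = of_real r"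
proof (cases "r = 0")
  case True
  have "conj (0 + 0 :: 'k) = conj 0 + conj 0" by (rule conj_add)
  with True show ?thesis by simp
next
  case False
  have "(of_real r :: 'k) * conj (of_real r) = of_real r * of_real r"
    by (simp add: mult_conj power2_eq_square)
  with False show ?thesis by simp
qed

lemma conj_0 [simp]: "conj (0 :: 'k::real_or_complex) = 0"
  using conj_of_real[of 0] by simp

lemma norm_conj [simp]: "norm (conj (x :: 'k::real_or_complex)) = norm x"
proof (cases "x = 0")
  case False
  have "norm x * norm (conj x) = norm x * norm x"
    by (metis abs_power2 mult_conj norm_mult norm_of_real power2_eq_square)
  with False show ?thesis by simp
qed simp

lemma conj_conj [simp]: "conj (conj (x :: 'k::real_or_complex)) = x"
proof (cases "x = 0")
  case False
  then have "conj x \<noteq> 0" by (metis norm_conj norm_eq_zero)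
  moreover have "conj x * conj (conj x) = conj x * x"
    using mult_conj[of "conj x"] mult_conj[of x] by (simp add: mult.commute)
  ultimately show ?thesis by simp
qed simp

lemma bounded_linear_conj: "bounded_linear (conj :: 'k::real_or_complex \<Rightarrow> 'k)"
  by (rule bounded_linear_intro[where K = 1])
     (simp_all add: conj_add conj_mult conj_of_real scaleR_conv_of_real)

section \<open>Hilbert spaces\<close>

text \<open>
  A type of class \<open>banach\<close> carrying an inner product (linear in the first argument) over
  \<open>'k\<close> that induces its norm.
\<close>

locale hilbert_space = vector_space smul
  for smul :: "'k::real_or_complex \<Rightarrow> 'h::banach \<Rightarrow> 'h" +
  fixes ip :: "'h \<Rightarrow> 'h \<Rightarrow> 'k"
  assumes smul_of_real: "smul (of_real r) x = r *\<^sub>R x"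
    and ip_add_left: "ip (x + y) z = ip x z + ip y z"
    and ip_smul_left: "ip (smul c x) y = c * ip x y"
    and ip_commute: "ip x y = conj (ip y x)"
    and ip_self: "ip x x = of_real ((norm x)\<^sup>2)"

abbreviation kspan :: "('k::field \<Rightarrow> 'h::ab_group_add \<Rightarrow> 'h) \<Rightarrow> 'h set \<Rightarrow> 'h set" where
  "kspan smul \<equiv> module.span smul"

definition ortho :: "('h \<Rightarrow> 'h \<Rightarrow> 'k::zero) \<Rightarrow> 'h set \<Rightarrow> 'h set" where
  "ortho ip S = {x. \<forall>y\<in>S. ip x y = 0}"

text \<open>Only meaningful if \<open>M\<close> is a closed subspace.\<close>

definition orth_proj ::
    "('h \<Rightarrow> 'h \<Rightarrow> 'k::zero) \<Rightarrow> 'h::ab_group_add set \<Rightarrow> 'h \<Rightarrow> 'h" where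
  "orth_proj ip M x = (THE y. y \<in> M \<and> x - y \<in> ortho ip M)"

definition nullspace :: "('a \<Rightarrow> 'b::zero) \<Rightarrow> 'a set" where
  "nullspace T = {x. T x = 0}"

text \<open>The cosine \<open>c[M, N]\<close> of the (Friedrichs) angle, with \<open>sup {} = 0\<close>.\<close>

definition angle_cos ::
    "('h \<Rightarrow> 'h \<Rightarrow> 'k::real_normed_vector) \<Rightarrow> 'h::real_normed_vector set \<Rightarrow> 'h set \<Rightarrow> real" where
  "angle_cos ip M N =
     (let S = {norm (ip x y) | x y. x \<in> M \<inter> ortho ip (M \<inter> N) \<and> y \<in> N \<inter> ortho ip (M \<inter> N) \<and>
                                    norm x = 1 \<and> norm y = 1}
      in if S = {} then 0 else Sup S)"

text \<open>Extended-real valued, so that the infimum of the empty set is \<open>\<infinity>\<close>.\<close>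

definition reduced_min_modulus ::
    "('h \<Rightarrow> 'h \<Rightarrow> 'k::zero) \<Rightarrow> ('h::real_normed_vector \<Rightarrow> 'g::real_normed_vector) \<Rightarrow> ereal" where
  "reduced_min_modulus ip T =
     (INF x\<in>{x. norm x = 1 \<and> x \<in> ortho ip (nullspace T)}. ereal (norm (T x)))"

section \<open>Frames\<close>

text \<open>The family \<open>f\<close>, indexed by \<open>I\<close>, is a frame for the closed subspace \<open>K\<close> with bounds \<open>A\<close>, \<open>B\<close>.\<close>

definition frame_with_bounds ::
    "('h \<Rightarrow> 'h \<Rightarrow> 'k::real_normed_vector) \<Rightarrow> 'h::real_normed_vector set \<Rightarrow> ('i \<Rightarrow> 'h) \<Rightarrow> 'i set
      \<Rightarrow> real \<Rightarrow> real \<Rightarrow> bool" where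
  "frame_with_bounds ip K f I A B \<longleftrightarrow>
     A > 0 \<and> B > 0 \<and> f ` I \<subseteq> K \<and>
     (\<forall>g\<in>K. (\<lambda>n. (norm (ip g (f n)))\<^sup>2) summable_on I \<and>
        A * (norm g)\<^sup>2 \<le> (\<Sum>\<^sub>\<infinity>n\<in>I. (norm (ip g (f n)))\<^sup>2) \<and>
        (\<Sum>\<^sub>\<infinity>n\<in>I. (norm (ip g (f n)))\<^sup>2) \<le> B * (norm g)\<^sup>2)"

definition is_frame ::
    "('h \<Rightarrow> 'h \<Rightarrow> 'k::real_normed_vector) \<Rightarrow> 'h::real_normed_vector set \<Rightarrow> ('i \<Rightarrow> 'h) \<Rightarrow> 'i set
      \<Rightarrow> bool" where
  "is_frame ip K f I \<longleftrightarrow> (\<exists>A B. frame_with_bounds ip K f I A B)"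

definition lower_frame_bound ::
    "('h \<Rightarrow> 'h \<Rightarrow> 'k::real_normed_vector) \<Rightarrow> 'h::real_normed_vector set \<Rightarrow> ('i \<Rightarrow> 'h) \<Rightarrow> 'i set
      \<Rightarrow> real \<Rightarrow> bool" where
  "lower_frame_bound ip K f I A \<longleftrightarrow> (\<exists>B. frame_with_bounds ip K f I A B)"

definition riesz_frame ::
    "('k::real_normed_field \<Rightarrow> 'h::real_normed_vector \<Rightarrow> 'h) \<Rightarrow> ('h \<Rightarrow> 'h \<Rightarrow> 'k)
      \<Rightarrow> (nat \<Rightarrow> 'h) \<Rightarrow> bool" where
  "riesz_frame smul ip f \<longleftrightarrow>
     is_frame ip UNIV f UNIV \<and>
     (\<exists>A>0. \<exists>B>0. \<forall>I. frame_with_bounds ip (closure (kspan smul (f ` I))) f I A B)"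

text \<open>Linear independence of the family (not just of its range).\<close>

definition indep_family ::
    "('k::field \<Rightarrow> 'h::ab_group_add \<Rightarrow> 'h) \<Rightarrow> ('i \<Rightarrow> 'h) \<Rightarrow> 'i set \<Rightarrow> bool" where
  "indep_family smul f J \<longleftrightarrow> inj_on f J \<and> \<not> module.dependent smul (f ` J)"

section \<open>The space of square-summable sequences\<close>

typedef (overloaded) ('k::real_or_complex) ell2 =
  "{x :: nat \<Rightarrow> 'k. summable (\<lambda>n. (norm (x n))\<^sup>2)}"
  morphisms seq Abs_ell2
  by (rule exI[of _ "\<lambda>_. 0"]) simp

setup_lifting type_definition_ell2

lemma summable_seq: "summable (\<lambda>n. (norm (seq x n))\<^sup>2)"
  using seq[of x] by simp

lemma ell2_eqI: "(\<And>n. seq x n = seq y n) \<Longrightarrow> x = y"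
  by (simp add: seq_inject[symmetric] fun_eq_iff)

lemma summable_sq_add:
  fixes x y :: "nat \<Rightarrow> 'k::real_normed_vector"
  assumes "summable (\<lambda>n. (norm (x n))\<^sup>2)" "summable (\<lambda>n. (norm (y n))\<^sup>2)"
  shows "summable (\<lambda>n. (norm (x n + y n))\<^sup>2)"
proof (rule summable_comparison_test')
  show "summable (\<lambda>n. 2 * (norm (x n))\<^sup>2 + 2 * (norm (y n))\<^sup>2)"
    using assms by (intro summable_add summable_mult)
  fix n
  have "(norm (x n + y n))\<^sup>2 \<le> (norm (x n) + norm (y n))\<^sup>2"
    by (simp add: norm_triangle_ineq power_mono)
  also have "\<dots> \<le> 2 * (norm (x n))\<^sup>2 + 2 * (norm (y n))\<^sup>2"
    using sum_squares_bound[of "norm (x n)" "norm (y n)"] by (simp add: power2_sum)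
  finally show "norm ((norm (x n + y n))\<^sup>2) \<le> 2 * (norm (x n))\<^sup>2 + 2 * (norm (y n))\<^sup>2"
    by simp
qed

lift_definition ell2_scale :: "'k::real_or_complex \<Rightarrow> 'k ell2 \<Rightarrow> 'k ell2"
  is "\<lambda>c x n. c * x n"
  by (simp add: norm_mult power_mult_distrib summable_mult)

lift_definition ell2_inner :: "'k::real_or_complex ell2 \<Rightarrow> 'k ell2 \<Rightarrow> 'k"
  is "\<lambda>x y. \<Sum>n. x n * conj (y n)" .

lift_definition ell2_unit :: "nat \<Rightarrow> 'k::real_or_complex ell2"
  is "\<lambda>i n. if n = i then 1 else 0"
proof -
  fix i :: nat
  show "summable (\<lambda>n. (norm (if n = i then 1 else 0 :: 'k))\<^sup>2)"
    by (rule summable_finite[of "{i}"]) auto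
qed

instantiation ell2 :: (real_or_complex) real_normed_vector
begin

lift_definition zero_ell2 :: "'a ell2" is "\<lambda>_. 0" by simp

lift_definition plus_ell2 :: "'a ell2 \<Rightarrow> 'a ell2 \<Rightarrow> 'a ell2" is "\<lambda>x y n. x n + y n"
  by (rule summable_sq_add)

lift_definition uminus_ell2 :: "'a ell2 \<Rightarrow> 'a ell2" is "\<lambda>x n. - x n" by simp

lift_definition minus_ell2 :: "'a ell2 \<Rightarrow> 'a ell2 \<Rightarrow> 'a ell2" is "\<lambda>x y n. x n - y n"
proof -
  fix x y :: "nat \<Rightarrow> 'a"
  assume "summable (\<lambda>n. (norm (x n))\<^sup>2)" "summable (\<lambda>n. (norm (y n))\<^sup>2)"
  then show "summable (\<lambda>n. (norm (x n - y n))\<^sup>2)"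
    using summable_sq_add[of x "\<lambda>n. - y n"] by simp
qed

lift_definition scaleR_ell2 :: "real \<Rightarrow> 'a ell2 \<Rightarrow> 'a ell2" is "\<lambda>r x n. r *\<^sub>R x n"
  by (simp add: power_mult_distrib summable_mult)

lift_definition norm_ell2 :: "'a ell2 \<Rightarrow> real" is "\<lambda>x. sqrt (\<Sum>n. (norm (x n))\<^sup>2)" .

definition sgn_ell2 :: "'a ell2 \<Rightarrow> 'a ell2" where
  "sgn_ell2 x = inverse (norm x) *\<^sub>R x"

definition dist_ell2 :: "'a ell2 \<Rightarrow> 'a ell2 \<Rightarrow> real" where
  "dist_ell2 x y = norm (x - y)"

definition uniformity_ell2 :: "('a ell2 \<times> 'a ell2) filter" where
  "uniformity_ell2 = (INF e\<in>{0<..}. principal {(x, y). dist x y < e})"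

definition open_ell2 :: "'a ell2 set \<Rightarrow> bool" where
  "open_ell2 U \<longleftrightarrow> (\<forall>x\<in>U. eventually (\<lambda>(x', y). x' = x \<longrightarrow> y \<in> U) uniformity)"

lemma L2_le_norm: "sqrt (\<Sum>n<k. (norm (seq x n))\<^sup>2) \<le> norm (x :: 'a ell2)"
  unfolding norm_ell2.rep_eq by (simp add: sum_le_suminf summable_seq)

lemma norm_ell2_leI:
  assumes "\<And>k. sqrt (\<Sum>n<k. (norm (seq x n))\<^sup>2) \<le> c"
  shows "norm (x :: 'a ell2) \<le> c"
proof -
  have c: "0 \<le> c" using assms[of 0] by simp
  have "(\<Sum>n<k. (norm (seq x n))\<^sup>2) \<le> c\<^sup>2" for k
    using assms[of k] by (rule sqrt_le_D)
  then have "(\<Sum>n. (norm (seq x n))\<^sup>2) \<le> c\<^sup>2"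
    by (intro suminf_le_const summable_seq) 
  with c show ?thesis unfolding norm_ell2.rep_eq by (simp add: real_le_lsqrt suminf_nonneg summable_seq)
qed

instance
proof
  fix x y z :: "'a ell2" and r s :: real
  show "dist x y = norm (x - y)" by (rule dist_ell2_def)
  show "x + y + z = x + (y + z)" by transfer (simp add: add.assoc)
  show "x + y = y + x" by transfer (simp add: add.commute)
  show "0 + x = x" by transfer simp
  show "- x + x = 0" by transfer simp
  show "x - y = x + - y" by transfer simp
  show "r *\<^sub>R (x + y) = r *\<^sub>R x + r *\<^sub>R y" by transfer (simp add: scaleR_add_right)
  show "(r + s) *\<^sub>R x = r *\<^sub>R x + s *\<^sub>R x" by transfer (simp add: scaleR_add_left)
  show "r *\<^sub>R s *\<^sub>R x = (r * s) *\<^sub>R x" by transfer simp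
  show "1 *\<^sub>R x = x" by transfer simp
  show "sgn x = inverse (norm x) *\<^sub>R x" by (rule sgn_ell2_def)
  show "uniformity = (INF e\<in>{0<..}. principal {(x, y :: 'a ell2). dist x y < e})"
    by (rule uniformity_ell2_def)
  show "open U \<longleftrightarrow> (\<forall>x\<in>U. \<forall>\<^sub>F (x', y) in uniformity. x' = x \<longrightarrow> y \<in> U)" for U :: "'a ell2 set"
    by (rule open_ell2_def)
  show "(norm x = 0) = (x = 0)"
  proof transfer
    fix x :: "nat \<Rightarrow> 'a"
    assume "summable (\<lambda>n. (norm (x n))\<^sup>2)"
    then show "(sqrt (\<Sum>n. (norm (x n))\<^sup>2) = 0) = (x = (\<lambda>_. 0))"
      by (simp add: suminf_eq_zero_iff fun_eq_iff)
  qed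
  show "norm (x + y) \<le> norm x + norm y"
  proof (rule norm_ell2_leI)
    fix k
    have "sqrt (\<Sum>n<k. (norm (seq (x + y) n))\<^sup>2)
        \<le> L2_set (\<lambda>n. norm (seq x n) + norm (seq y n)) {..<k}"
      unfolding L2_set_def plus_ell2.rep_eq
      by (intro real_sqrt_le_mono sum_mono power_mono norm_triangle_ineq) simp
    also have "\<dots> \<le> L2_set (\<lambda>n. norm (seq x n)) {..<k} + L2_set (\<lambda>n. norm (seq y n)) {..<k}"
      by (rule L2_set_triangle_ineq)
    also have "\<dots> \<le> norm x + norm y"
      unfolding L2_set_def by (intro add_mono L2_le_norm)
    finally show "sqrt (\<Sum>n<k. (norm (seq (x + y) n))\<^sup>2) \<le> norm x + norm y" .
  qed
  show "norm (r *\<^sub>R x) = \<bar>r\<bar> * norm x"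
    by transfer (simp add: power_mult_distrib suminf_mult real_sqrt_mult)
qed

end

instance ell2 :: (real_or_complex) banach
proof
  fix X :: "nat \<Rightarrow> 'a ell2"
  assume "Cauchy X"
  have coord: "norm (seq x n) \<le> norm x" for x :: "'a ell2" and n
  proof -
    have "norm (seq x n) \<le> L2_set (\<lambda>n. norm (seq x n)) {..<Suc n}"
      by (rule member_le_L2_set) auto
    also have "\<dots> \<le> norm x" unfolding L2_set_def by (rule L2_le_norm)
    finally show ?thesis .
  qed
  have "Cauchy (\<lambda>m. seq (X m) n)" for n
  proof (rule CauchyI)
    fix e :: real assume "0 < e"
    then obtain M where "\<forall>m\<ge>M. \<forall>k\<ge>M. norm (X m - X k) < e"
      using CauchyD[OF \<open>Cauchy X\<close>] by blast
    then show "\<exists>M. \<forall>m\<ge>M. \<forall>k\<ge>M. norm (seq (X m) n - seq (X k) n) < e"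
      using coord[of "X _ - X _" n] unfolding minus_ell2.rep_eq by (meson le_less_trans)
  qed
  then have "\<forall>n. \<exists>l. (\<lambda>m. seq (X m) n) \<longlonglongrightarrow> l"
    using Cauchy_convergent_iff convergent_def by blast
  then obtain l where l: "\<And>n. (\<lambda>m. seq (X m) n) \<longlonglongrightarrow> l n" by metis
  have part: "\<exists>M. \<forall>m\<ge>M. \<forall>k. sqrt (\<Sum>n<k. (norm (seq (X m) n - l n))\<^sup>2) \<le> e"
    if e: "0 < e" for e
  proof -
    obtain M where M: "\<forall>m\<ge>M. \<forall>k\<ge>M. norm (X m - X k) < e"
      using CauchyD[OF \<open>Cauchy X\<close> e] by blast
    have "sqrt (\<Sum>n<k. (norm (seq (X m) n - l n))\<^sup>2) \<le> e" if "m \<ge> M" for m k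
    proof (rule LIMSEQ_le_const2)
      show "(\<lambda>j. sqrt (\<Sum>n<k. (norm (seq (X m) n - seq (X j) n))\<^sup>2))
          \<longlonglongrightarrow> sqrt (\<Sum>n<k. (norm (seq (X m) n - l n))\<^sup>2)"
        by (intro tendsto_intros l)
      have "sqrt (\<Sum>n<k. (norm (seq (X m) n - seq (X j) n))\<^sup>2) \<le> e" if "j \<ge> M" for j
        using L2_le_norm[of "X m - X j" k] M \<open>m \<ge> M\<close> that unfolding minus_ell2.rep_eq
        by (meson less_imp_le order_trans)
      then show "\<exists>N. \<forall>j\<ge>N. sqrt (\<Sum>n<k. (norm (seq (X m) n - seq (X j) n))\<^sup>2) \<le> e"
        by blast
    qed
    then show ?thesis by blast
  qed
  obtain M where M: "\<And>k. sqrt (\<Sum>n<k. (norm (seq (X M) n - l n))\<^sup>2) \<le> 1"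
    using part[of 1] by auto
  have "summable (\<lambda>n. (norm (seq (X M) n - l n))\<^sup>2)"
  proof (rule summableI_nonneg_bounded)
    show "(\<Sum>n<k. (norm (seq (X M) n - l n))\<^sup>2) \<le> 1" for k
      using sqrt_le_D[OF M[of k]] by simp
  qed simp
  then have "summable (\<lambda>n. (norm (- (seq (X M) n - l n)))\<^sup>2)"
    by (simp only: norm_minus_cancel)
  from summable_sq_add[OF summable_seq[of "X M"] this]
  have "summable (\<lambda>n. (norm (l n))\<^sup>2)" by simp
  then have L: "seq (Abs_ell2 l) = l" by (simp add: Abs_ell2_inverse)
  have "X \<longlonglongrightarrow> Abs_ell2 l"
  proof (rule LIMSEQ_I)
    fix r :: real assume "0 < r"
    then obtain M where "\<forall>m\<ge>M. \<forall>k. sqrt (\<Sum>n<k. (norm (seq (X m) n - l n))\<^sup>2) \<le> r / 2"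
      using part[of "r / 2"] by auto
    then have "\<forall>m\<ge>M. norm (X m - Abs_ell2 l) \<le> r / 2"
      by (intro allI impI norm_ell2_leI) (simp add: minus_ell2.rep_eq L)
    then show "\<exists>no. \<forall>n\<ge>no. norm (X n - Abs_ell2 l) < r"
      using \<open>0 < r\<close> by (intro exI[of _ M]) fastforce
  qed
  then show "convergent X" by (rule convergentI)
qed

lemma summable_ell2_inner: "summable (\<lambda>n. seq x n * conj (seq y n))"
proof (rule summable_comparison_test')
  show "summable (\<lambda>n. (norm (seq x n))\<^sup>2 + (norm (seq y n))\<^sup>2)"
    by (intro summable_add summable_seq)
  show "norm (seq x n * conj (seq y n)) \<le> (norm (seq x n))\<^sup>2 + (norm (seq y n))\<^sup>2" for n
  proof -
    have "0 \<le> norm (seq x n) * norm (seq y n)" by simp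
    then show ?thesis
      using sum_squares_bound[of "norm (seq x n)" "norm (seq y n)"]
      unfolding norm_mult norm_conj by linarith
  qed
qed

theorem hilbert_space_ell2: "hilbert_space ell2_scale ell2_inner"
proof
  fix a b c :: 'a and x y z :: "'a ell2" and r :: real
  show "ell2_scale a (x + y) = ell2_scale a x + ell2_scale a y"
    by transfer (simp add: distrib_left)
  show "ell2_scale (a + b) x = ell2_scale a x + ell2_scale b x"
    by transfer (simp add: distrib_right)
  show "ell2_scale a (ell2_scale b x) = ell2_scale (a * b) x"
    by transfer (simp add: mult.assoc)
  show "ell2_scale 1 x = x" by transfer simp
  show "ell2_scale (of_real r) x = r *\<^sub>R x"
    by transfer (simp add: scaleR_conv_of_real)
  show "ell2_inner (x + y) z = ell2_inner x z + ell2_inner y z"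
    unfolding ell2_inner.rep_eq plus_ell2.rep_eq
    by (simp add: distrib_right suminf_add summable_ell2_inner)
  show "ell2_inner (ell2_scale c x) y = c * ell2_inner x y"
    unfolding ell2_inner.rep_eq ell2_scale.rep_eq
    by (simp add: mult.assoc suminf_mult summable_ell2_inner)
  show "ell2_inner x y = conj (ell2_inner y x)"
    unfolding ell2_inner.rep_eq
    by (simp add: bounded_linear.suminf[OF bounded_linear_conj summable_ell2_inner]
        conj_mult mult.commute)
  show "ell2_inner x x = of_real ((norm x)\<^sup>2)"
    unfolding ell2_inner.rep_eq norm_ell2.rep_eq
    by (simp add: mult_conj suminf_nonneg summable_seq suminf_of_real[symmetric]
        flip: of_real_power)
qed

definition coord_subspace :: "nat set \<Rightarrow> 'k::real_or_complex ell2 set" where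
  "coord_subspace I = closure (kspan ell2_scale (ell2_unit ` I))"

text \<open>Compatibility of a closed subspace with the canonical orthonormal basis.\<close>

definition basis_compatible :: "'k::real_or_complex ell2 set \<Rightarrow> bool" where
  "basis_compatible N \<longleftrightarrow> (SUP I. angle_cos ell2_inner N (coord_subspace I)) < 1"

text \<open>For a frame \<open>f\<close>, there is exactly one such operator \<open>T\<close>.\<close>

definition synthesis_operator ::
    "('k::real_or_complex \<Rightarrow> 'h::real_normed_vector \<Rightarrow> 'h) \<Rightarrow> (nat \<Rightarrow> 'h) \<Rightarrow> ('k ell2 \<Rightarrow> 'h)
      \<Rightarrow> bool" where
  "synthesis_operator smul f T \<longleftrightarrow>
     bounded_linear T \<and> (\<forall>c x. T (ell2_scale c x) = smul c (T x)) \<and> (\<forall>n. T (ell2_unit n) = f n)"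

end

theory Submission
  imports Defs
begin

text \<open>
  For a set \<open>I\<close> of indices, let \<open>T\<^sub>I\<close> be the restriction of \<open>T\<close> to the coordinate subspace \<open>M\<^sub>I\<close>.
  Its adjoint is the analysis operator, which sends \<open>g\<close> to the sequence of the inner products
  \<open>\<langle>g, f\<^sub>n\<rangle>\<close> with \<open>n \<in> I\<close>. All four conditions say that the operators \<open>T\<^sub>I\<close> are bounded below away
  from their kernels \<open>N \<inter> M\<^sub>I\<close>, with one constant for all \<open>I\<close> in a certain class.

  The lower bound \<open>A\<close> for the frame sequence \<open>(f\<^sub>n)\<^sub>n\<^sub>\<in>\<^sub>I\<close> says that the adjoint of \<open>T\<^sub>I\<close> is bounded below by
  \<open>\<surd>A\<close> on the span of \<open>f ` I\<close>. An operator and its adjoint are bounded below, away from their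
  kernels, by the same constants (\<open>lower_bound_on_imp_coercive_on\<close> and
  \<open>coercive_on_imp_lower_bound_on\<close>). So \<open>f\<close> is a Riesz frame if and only if all \<open>T\<^sub>I\<close> have a common
  lower bound on \<open>M\<^sub>I \<inter> (N \<inter> M\<^sub>I)\<^sup>\<bottom>\<close>.

  For compatibility, let \<open>y\<close> be a vector of \<open>M\<^sub>I \<inter> (N \<inter> M\<^sub>I)\<^sup>\<bottom>\<close>. As \<open>T\<close> is bounded, and bounded below on
  \<open>N\<^sup>\<bottom>\<close> because \<open>f\<close> is a frame, the norm of \<open>T y\<close> is comparable to the distance from \<open>y\<close> to \<open>N\<close>.
  That distance is bounded below by a multiple of the norm of \<open>y\<close> exactly when the angle between \<open>N\<close>
  and \<open>M\<^sub>I\<close> is bounded away from \<open>0\<close> (\<open>basis_compatible_iff\<close>).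

  Finite independent subfamilies suffice because the frame sum only grows with the index set: a
  vector in the span of \<open>f ` I\<close> already lies in the span of a finite independent subfamily \<open>f ` J\<close>
  with \<open>J \<subseteq> I\<close>, and the lower bound for \<open>J\<close> implies the one for \<open>I\<close> (\<open>lower_bound_on_from_finite\<close>).
  For finite \<open>J\<close>, independence of the family means \<open>N \<inter> M\<^sub>J = {0}\<close>, and then the reduced minimum
  modulus of \<open>T P\<^sub>J\<close> is the best lower bound of \<open>T\<^sub>J\<close> (\<open>reduced_min_modulus_iff\<close>).
\<close>

section \<open>Orthogonality in Hilbert spaces\<close>

context hilbert_space
begin

lemma ip_zero_left [simp]: "ip 0 x = 0"
  using ip_smul_left[of 0 0 x] by simp

lemma ip_zero_right [simp]: "ip x 0 = 0"
  by (subst ip_commute) simp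

lemma ip_eq_0_commute: "ip x y = 0 \<longleftrightarrow> ip y x = 0"
  by (metis ip_commute conj_0)

lemma norm_ip_commute: "norm (ip x y) = norm (ip y x)"
  by (metis ip_commute norm_conj)

lemma ip_add_right: "ip x (y + z) = ip x y + ip x z"
  by (metis conj_add ip_add_left ip_commute)

lemma ip_smul_right: "ip x (smul c y) = conj c * ip x y"
  by (metis conj_mult ip_commute ip_smul_left)

lemma ip_minus_left: "ip (- x) y = - ip x y"
  using ip_add_left[of x "- x" y] by (simp add: eq_neg_iff_add_eq_0 add.commute)

lemma ip_diff_left: "ip (x - y) z = ip x z - ip y z"
  using ip_add_left[of x "- y" z] by (simp add: ip_minus_left)

lemma ip_diff_right: "ip z (x - y) = ip z x - ip z y"
  using ip_add_right[of z "x - y" y] by simp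

lemma ip_scaleR_left: "ip (r *\<^sub>R x) y = of_real r * ip x y"
  by (metis ip_smul_left smul_of_real)

lemma norm_ip_self: "norm (ip x x) = (norm x)\<^sup>2"
  by (simp add: ip_self del: of_real_power)

lemma norm_smul: "norm (smul c x) = norm c * norm x"
proof -
  have "of_real ((norm (smul c x))\<^sup>2) = (of_real ((norm c * norm x)\<^sup>2) :: 'k)"
    using mult_conj[of c] mult.commute[of c "conj c"]
    unfolding ip_self[symmetric] power_mult_distrib of_real_mult
    by (simp add: ip_smul_left ip_smul_right mult.assoc[symmetric] del: of_real_power)
  then have "(norm (smul c x))\<^sup>2 = (norm c * norm x)\<^sup>2"
    by (simp only: of_real_eq_iff)
  then show ?thesis by (simp add: power2_eq_iff_nonneg)
qed

lemma norm_add_sq: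
  "of_real ((norm (x + y))\<^sup>2) = of_real ((norm x)\<^sup>2) + of_real ((norm y)\<^sup>2) + (ip x y + ip y x)"
  unfolding ip_self[symmetric] by (simp add: ip_add_left ip_add_right algebra_simps)

lemma pythagoras:
  assumes "ip x y = 0"
  shows "(norm (x + y))\<^sup>2 = (norm x)\<^sup>2 + (norm y)\<^sup>2"
proof -
  have "ip y x = 0" using assms ip_eq_0_commute by blast
  then have "of_real ((norm (x + y))\<^sup>2) = (of_real ((norm x)\<^sup>2 + (norm y)\<^sup>2) :: 'k)"
    using assms norm_add_sq[of x y] by simp
  then show ?thesis by (simp only: of_real_eq_iff)
qed

lemma parallelogram:
  fixes x y :: 'h
  shows "(norm (x + y))\<^sup>2 + (norm (x - y))\<^sup>2 = 2 * (norm x)\<^sup>2 + 2 * (norm y)\<^sup>2"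
proof -
  have "ip (x + y) (x + y) + ip (x - y) (x - y) = 2 * ip x x + 2 * ip y y"
    by (simp add: ip_add_left ip_add_right ip_diff_left ip_diff_right algebra_simps)
  then have "of_real ((norm (x + y))\<^sup>2 + (norm (x - y))\<^sup>2)
      = (of_real (2 * (norm x)\<^sup>2 + 2 * (norm y)\<^sup>2) :: 'k)"
    by (simp add: ip_self)
  then show ?thesis by (simp only: of_real_eq_iff)
qed

text \<open>
  The distance from \<open>x\<close> to the line through \<open>u\<close>. Its nonnegativity gives the Cauchy--Schwarz
  inequality; it also turns minimality of a distance into orthogonality, and an angle into a
  distance.
\<close>

lemma norm_reject_unit_sq:
  assumes "norm u = 1"
  shows "(norm (x - smul (ip x u) u))\<^sup>2 = (norm x)\<^sup>2 - (norm (ip x u))\<^sup>2"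
proof -
  have "ip (x - smul (ip x u) u) u = 0"
    by (simp add: ip_diff_left ip_smul_left ip_self assms)
  then have "ip (x - smul (ip x u) u) (smul (ip x u) u) = 0"
    by (simp add: ip_smul_right)
  from pythagoras[OF this] show ?thesis by (simp add: norm_smul assms)
qed

lemma cauchy_schwarz: "norm (ip x y) \<le> norm x * norm y"
proof (cases "y = 0")
  case False
  define u where "u = (1 / norm y) *\<^sub>R y"
  have u: "norm u = 1" using False by (simp add: u_def)
  have "0 \<le> (norm x)\<^sup>2 - (norm (ip x u))\<^sup>2"
    using norm_reject_unit_sq[OF u, of x] by (metis zero_le_power2)
  then have "norm (ip x u) \<le> norm x"
    by (simp add: abs_le_square_iff[symmetric])
  moreover have "norm (ip x u) = norm (ip x y) / norm y"
    by (subst norm_ip_commute)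
       (simp add: u_def ip_scaleR_left norm_mult norm_divide norm_ip_commute[of x y])
  ultimately show ?thesis using False by (simp add: divide_le_eq)
qed simp

lemma bounded_linear_ip_left: "bounded_linear (\<lambda>x. ip x y)"
  by (rule bounded_linear_intro[where K = "norm y"])
     (simp_all add: ip_add_left ip_scaleR_left scaleR_conv_of_real cauchy_schwarz)

lemma subspace_ortho: "subspace (ortho ip S)"
  by (auto simp: subspace_def ortho_def ip_add_left ip_smul_left)

lemma ortho_disjoint: "x \<in> M \<Longrightarrow> x \<in> ortho ip M \<Longrightarrow> x = 0"
  using ip_self[of x] by (auto simp: ortho_def)

lemma subspace_scaleR: "subspace S \<Longrightarrow> x \<in> S \<Longrightarrow> r *\<^sub>R x \<in> S"
  by (metis smul_of_real subspace_scale)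

text \<open>
  A minimizing sequence is Cauchy, because the midpoint of two of its members also lies in \<open>M\<close>, and
  the parallelogram law bounds their distance by how close they are to the minimum.
\<close>

lemma nearest_point_exists:
  assumes M: "subspace M" "closed M"
  obtains y where "y \<in> M" "\<And>z. z \<in> M \<Longrightarrow> norm (x - y) \<le> norm (x - z)"
proof -
  define d where "d = (INF z\<in>M. (norm (x - z))\<^sup>2)"
  have ne: "M \<noteq> {}" using M subspace_0 by blast
  have bdd: "bdd_below ((\<lambda>z. (norm (x - z))\<^sup>2) ` M)" by (rule bdd_belowI2[of _ 0]) simp
  have d: "d \<le> (norm (x - z))\<^sup>2" if "z \<in> M" for z
    unfolding d_def by (rule cINF_lower[OF bdd that])
  have "\<exists>z\<in>M. (norm (x - z))\<^sup>2 < d + 1 / real (Suc n)" for n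
    using cINF_less_iff[OF ne bdd, of "d + 1 / real (Suc n)"] by (simp add: d_def)
  then obtain Y where Y: "\<And>n. Y n \<in> M" "\<And>n. (norm (x - Y n))\<^sup>2 < d + 1 / real (Suc n)"
    by metis
  have close: "(norm (Y m - Y n))\<^sup>2 \<le> 2 / real (Suc m) + 2 / real (Suc n)" for m n
  proof -
    have mid: "(1/2) *\<^sub>R (Y m + Y n) \<in> M"
      using Y M by (intro subspace_scaleR subspace_add)
    have "(x - Y m) + (x - Y n) = 2 *\<^sub>R (x - (1/2) *\<^sub>R (Y m + Y n))"
      by (simp add: algebra_simps scaleR_2)
    then have "(norm ((x - Y m) + (x - Y n)))\<^sup>2 = 4 * (norm (x - (1/2) *\<^sub>R (Y m + Y n)))\<^sup>2"
      by (simp add: power_mult_distrib)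
    moreover have "norm ((x - Y m) - (x - Y n)) = norm (Y m - Y n)"
      by (simp add: norm_minus_commute)
    ultimately show ?thesis
      using parallelogram[of "x - Y m" "x - Y n"] d[OF mid] Y(2)[of m] Y(2)[of n] by simp
  qed
  have "Cauchy Y"
  proof (rule CauchyI)
    fix e :: real assume e: "0 < e"
    obtain K where K: "inverse (real (Suc K)) < e\<^sup>2 / 4"
      using reals_Archimedean[of "e\<^sup>2 / 4"] e by auto
    have "norm (Y m - Y n) < e" if "m \<ge> K" "n \<ge> K" for m n
    proof -
      have "1 / real (Suc m) \<le> 1 / real (Suc K)" "1 / real (Suc n) \<le> 1 / real (Suc K)"
        using that by (simp_all add: frac_le)
      then have "(norm (Y m - Y n))\<^sup>2 < e\<^sup>2"
        using close[of m n] K by (simp add: inverse_eq_divide)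
      then show ?thesis using e by (simp add: power_less_imp_less_base)
    qed
    then show "\<exists>K. \<forall>m\<ge>K. \<forall>n\<ge>K. norm (Y m - Y n) < e" by blast
  qed
  then obtain y where y: "Y \<longlonglongrightarrow> y" using Cauchy_convergent convergent_def by blast
  have "y \<in> M" using closed_sequentially[OF M(2) Y(1) y] .
  moreover have "(norm (x - y))\<^sup>2 \<le> d"
  proof (rule LIMSEQ_le)
    show "(\<lambda>n. (norm (x - Y n))\<^sup>2) \<longlonglongrightarrow> (norm (x - y))\<^sup>2" by (intro tendsto_intros y)
    show "(\<lambda>n. d + 1 / real (Suc n)) \<longlonglongrightarrow> d"
      using tendsto_add[OF tendsto_const LIMSEQ_inverse_real_of_nat, of d]
      by (simp add: inverse_eq_divide)
    show "\<exists>K. \<forall>n\<ge>K. (norm (x - Y n))\<^sup>2 \<le> d + 1 / real (Suc n)"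
      using Y(2) less_imp_le by blast
  qed
  then have "norm (x - y) \<le> norm (x - z)" if "z \<in> M" for z
    using d[OF that] by (meson norm_ge_zero order_trans power2_le_imp_le)
  ultimately show ?thesis using that by blast
qed

text \<open>
  The nearest point is the projection: if the difference had a component along a unit vector \<open>u\<close> of
  \<open>M\<close>, subtracting that component would bring it closer.
\<close>

theorem projection_exists:
  assumes M: "subspace M" "closed M"
  obtains y where "y \<in> M" "x - y \<in> ortho ip M"
proof -
  obtain y where y: "y \<in> M" and min: "\<And>z. z \<in> M \<Longrightarrow> norm (x - y) \<le> norm (x - z)"
    using nearest_point_exists[OF M] by metis
  have unit: "ip (x - y) u = 0" if u: "u \<in> M" "norm u = 1" for u
  proof -
    have "y + smul (ip (x - y) u) u \<in> M" using y u M by (intro subspace_add subspace_scale)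
    from min[OF this] have "norm (x - y) \<le> norm ((x - y) - smul (ip (x - y) u) u)"
      by (simp add: algebra_simps)
    then have "(norm (x - y))\<^sup>2 \<le> (norm ((x - y) - smul (ip (x - y) u) u))\<^sup>2"
      by (rule power_mono) simp
    then show ?thesis unfolding norm_reject_unit_sq[OF u(2)] by simp
  qed
  have "ip (x - y) z = 0" if z: "z \<in> M" for z
  proof (cases "z = 0")
    case False
    have "ip (x - y) ((1 / norm z) *\<^sub>R z) = 0"
      using False z M by (intro unit subspace_scaleR) auto
    then have "ip ((1 / norm z) *\<^sub>R z) (x - y) = 0" using ip_eq_0_commute by blast
    then show ?thesis using False by (simp add: ip_scaleR_left ip_eq_0_commute)
  qed simp
  then have "x - y \<in> ortho ip M" by (simp add: ortho_def)
  with y that show ?thesis by blast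
qed

lemma orth_proj_eqI:
  assumes "subspace M" "y \<in> M" "x - y \<in> ortho ip M"
  shows "orth_proj ip M x = y"
  unfolding orth_proj_def
proof (rule the_equality)
  fix z assume z: "z \<in> M \<and> x - z \<in> ortho ip M"
  have "z - y \<in> M" using assms z by (intro subspace_diff) auto
  moreover have "(x - y) - (x - z) \<in> ortho ip M"
    using assms(3) z subspace_diff[OF subspace_ortho] by blast
  then have "z - y \<in> ortho ip M" by simp
  ultimately have "z - y = 0" by (rule ortho_disjoint)
  then show "z = y" by simp
qed (use assms in auto)

lemma ortho_ortho:
  assumes M: "subspace M" "closed M"
  shows "ortho ip (ortho ip M) = M"
proof
  show "M \<subseteq> ortho ip (ortho ip M)"
    by (auto simp: ortho_def) (metis ip_eq_0_commute)
  show "ortho ip (ortho ip M) \<subseteq> M"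
  proof
    fix x assume x: "x \<in> ortho ip (ortho ip M)"
    obtain y where y: "y \<in> M" "x - y \<in> ortho ip M" using projection_exists[OF M] by blast
    have "ip (x - y) (x - y) = 0"
      using x y ip_eq_0_commute[of y] by (simp add: ip_diff_left ortho_def)
    then show "x \<in> M" using y by (simp add: ip_self)
  qed
qed

lemma subspace_closure:
  assumes S: "subspace S"
  shows "subspace (closure S)"
proof (rule subspaceI)
  show "0 \<in> closure S" using S closure_subset subspace_0 by blast
  show "x + y \<in> closure S" if xy: "x \<in> closure S" "y \<in> closure S" for x y
  proof -
    obtain X Y where "\<And>n. X n \<in> S" "X \<longlonglongrightarrow> x" "\<And>n. Y n \<in> S" "Y \<longlonglongrightarrow> y"
      using xy unfolding closure_sequential by blast
    then show ?thesis
      unfolding closure_sequential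
      by (intro CollectI exI[of _ "\<lambda>n. X n + Y n"] conjI allI tendsto_add subspace_add[OF S])
  qed
  show "smul c x \<in> closure S" if x: "x \<in> closure S" for c x
  proof -
    have "smul c (r *\<^sub>R x) = r *\<^sub>R smul c x" for r x
      by (metis smul_of_real scale_left_commute)
    then have smul: "bounded_linear (smul c)"
      by (intro bounded_linear_intro[where K = "norm c"])
         (simp_all add: scale_right_distrib norm_smul)
    obtain X where "\<And>n. X n \<in> S" "X \<longlonglongrightarrow> x"
      using x unfolding closure_sequential by blast
    then show ?thesis
      unfolding closure_sequential
      by (intro CollectI exI[of _ "\<lambda>n. smul c (X n)"] conjI allI bounded_linear.tendsto[OF smul]
          subspace_scale[OF S])
  qed
qed

lemma indep_family_iff:
  assumes "finite J"
  shows "indep_family smul g J \<longleftrightarrow>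
    (\<forall>c. (\<Sum>i\<in>J. smul (c i) (g i)) = 0 \<longrightarrow> (\<forall>i\<in>J. c i = 0))"
proof
  assume ind: "indep_family smul g J"
  then have inj: "inj_on g J" and indep: "\<not> dependent (g ` J)"
    by (auto simp: indep_family_def)
  show "\<forall>c. (\<Sum>i\<in>J. smul (c i) (g i)) = 0 \<longrightarrow> (\<forall>i\<in>J. c i = 0)"
  proof (intro allI impI ballI)
    fix c i assume c: "(\<Sum>i\<in>J. smul (c i) (g i)) = 0" and i: "i \<in> J"
    have "(\<Sum>v\<in>g ` J. smul (c (inv_into J g v)) v) = 0"
      using c inj by (simp add: sum.reindex)
    then have "c (inv_into J g (g i)) = 0"
      using independentD[OF indep, of "g ` J" "\<lambda>v. c (inv_into J g v)" "g i"] assms i by simp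
    then show "c i = 0" using inj i by simp
  qed
next
  assume coeffs: "\<forall>c. (\<Sum>i\<in>J. smul (c i) (g i)) = 0 \<longrightarrow> (\<forall>i\<in>J. c i = 0)"
  have inj: "inj_on g J"
  proof (rule inj_onI, rule ccontr)
    fix i j assume ij: "i \<in> J" "j \<in> J" "g i = g j" "i \<noteq> j"
    define c where "c k = (if k = i then 1 else if k = j then - 1 else 0 :: 'k)" for k
    have "(\<Sum>k\<in>J. smul (c k) (g k)) = (\<Sum>k\<in>{i, j}. smul (c k) (g k))"
      using ij assms by (intro sum.mono_neutral_right) (auto simp: c_def)
    also have "\<dots> = 0" using ij by (simp add: c_def)
    finally have "c i = 0" using coeffs ij by blast
    then show False by (simp add: c_def)
  qed
  have "\<not> dependent (g ` J)"
  proof (rule independent_if_scalars_zero)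
    show "finite (g ` J)" using assms by simp
    fix u v assume u: "(\<Sum>x\<in>g ` J. smul (u x) x) = 0" and v: "v \<in> g ` J"
    have "(\<Sum>i\<in>J. smul (u (g i)) (g i)) = 0" using u inj by (simp add: sum.reindex)
    then have "\<forall>i\<in>J. u (g i) = 0" using coeffs[rule_format, of "\<lambda>i. u (g i)"] by blast
    then show "u v = 0" using v by blast
  qed
  with inj show "indep_family smul g J" by (simp add: indep_family_def)
qed

end

section \<open>Coordinate subspaces\<close>

interpretation ell2: hilbert_space ell2_scale ell2_inner
  by (rule hilbert_space_ell2)

lemma norm_ell2_sq: "(norm x)\<^sup>2 = (\<Sum>n. (norm (seq x n))\<^sup>2)"
  by (simp add: norm_ell2.rep_eq suminf_nonneg summable_seq)

lemma norm_seq_le: "norm (seq x n) \<le> norm x"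
proof -
  have "(norm (seq x n))\<^sup>2 \<le> (\<Sum>k<Suc n. (norm (seq x k))\<^sup>2)"
    by (rule member_le_sum) auto
  then have "norm (seq x n) \<le> sqrt (\<Sum>k<Suc n. (norm (seq x k))\<^sup>2)"
    by (rule real_le_rsqrt)
  also have "\<dots> \<le> norm x" by (rule L2_le_norm)
  finally show ?thesis .
qed

lemma bounded_linear_seq: "bounded_linear (\<lambda>x. seq x n)"
  by (rule bounded_linear_intro[where K = 1])
     (simp_all add: plus_ell2.rep_eq scaleR_ell2.rep_eq norm_seq_le)

lemma seq_sum: "seq (\<Sum>i\<in>A. g i) n = (\<Sum>i\<in>A. seq (g i) n)"
  using linear_sum[OF bounded_linear.linear[OF bounded_linear_seq]] .

lemma seq_truncation:
  "seq (\<Sum>i<k. ell2_scale (seq x i) (ell2_unit i)) n = (if n < k then seq x n else 0)"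
  by (simp add: seq_sum ell2_scale.rep_eq ell2_unit.rep_eq if_distrib cong: if_cong)

text \<open>
  The square of the distance from \<open>x\<close> to its truncation is a tail of the series for its norm.
\<close>

lemma truncation_tendsto: "(\<lambda>k. \<Sum>i<k. ell2_scale (seq x i) (ell2_unit i)) \<longlonglongrightarrow> x"
proof -
  define t where "t k = (\<Sum>i<k. ell2_scale (seq x i) (ell2_unit i))" for k
  have "(norm (x - t k))\<^sup>2 = (\<Sum>n. (norm (seq x n))\<^sup>2) - (\<Sum>n<k. (norm (seq x n))\<^sup>2)" for k
  proof -
    have seq: "seq (x - t k) n = (if n < k then 0 else seq x n)" for n
      by (simp add: t_def minus_ell2.rep_eq seq_truncation)
    have "(\<Sum>n. (norm (seq (x - t k) n))\<^sup>2)
        = (\<Sum>n. (norm (seq (x - t k) (n + k)))\<^sup>2) + (\<Sum>n<k. (norm (seq (x - t k) n))\<^sup>2)"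
      by (rule suminf_split_initial_segment[OF summable_seq])
    moreover have "(\<Sum>n. (norm (seq x n))\<^sup>2)
        = (\<Sum>n. (norm (seq x (n + k)))\<^sup>2) + (\<Sum>n<k. (norm (seq x n))\<^sup>2)"
      by (rule suminf_split_initial_segment[OF summable_seq])
    ultimately show ?thesis by (simp add: norm_ell2_sq seq)
  qed
  moreover have "(\<lambda>k. (\<Sum>n. (norm (seq x n))\<^sup>2) - (\<Sum>n<k. (norm (seq x n))\<^sup>2)) \<longlonglongrightarrow> 0"
    using tendsto_diff[OF tendsto_const[of "\<Sum>n. (norm (seq x n))\<^sup>2"]
        summable_LIMSEQ[OF summable_seq[of x]]] by simp
  ultimately have "(\<lambda>k. (norm (x - t k))\<^sup>2) \<longlonglongrightarrow> 0" by simp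
  then have "(\<lambda>k. sqrt ((norm (x - t k))\<^sup>2)) \<longlonglongrightarrow> sqrt 0" by (rule tendsto_real_sqrt)
  then have "(\<lambda>k. norm (t k - x)) \<longlonglongrightarrow> 0" by (simp add: norm_minus_commute)
  then show ?thesis
    unfolding t_def by (simp add: LIM_zero_cancel tendsto_norm_zero_iff)
qed

lemma coord_subspace_eq:
  "coord_subspace I = {x :: 'k::real_or_complex ell2. \<forall>n. n \<notin> I \<longrightarrow> seq x n = 0}"
proof
  let ?S = "{x :: 'k ell2. \<forall>n. n \<notin> I \<longrightarrow> seq x n = 0}"
  have "?S = (\<Inter>n\<in>-I. {x. seq x n = 0})" by auto
  moreover have "closed {x :: 'k ell2. seq x n = 0}" for n
    by (intro closed_Collect_eq continuous_intros
        bounded_linear.continuous_on[OF bounded_linear_seq])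
  ultimately have "closed ?S" by auto
  moreover have "kspan ell2_scale (ell2_unit ` I) \<subseteq> ?S"
    by (rule ell2.span_minimal)
       (auto simp: ell2.subspace_def ell2_unit.rep_eq zero_ell2.rep_eq plus_ell2.rep_eq
         ell2_scale.rep_eq)
  ultimately show "coord_subspace I \<subseteq> ?S"
    unfolding coord_subspace_def by (rule closure_minimal[rotated])
next
  show "{x :: 'k ell2. \<forall>n. n \<notin> I \<longrightarrow> seq x n = 0} \<subseteq> coord_subspace I"
  proof
    fix x :: "'k ell2"
    assume x: "x \<in> {x. \<forall>n. n \<notin> I \<longrightarrow> seq x n = 0}"
    have "ell2_scale (seq x i) (ell2_unit i) \<in> kspan ell2_scale (ell2_unit ` I)" for i
    proof (cases "i \<in> I")
      case True
      then show ?thesis by (intro ell2.span_scale ell2.span_base) auto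
    next
      case False
      then have "ell2_scale (seq x i) (ell2_unit i) = 0" using x by simp
      then show ?thesis by (simp only: ell2.span_zero)
    qed
    then have "(\<Sum>i<k. ell2_scale (seq x i) (ell2_unit i)) \<in> kspan ell2_scale (ell2_unit ` I)" for k
      by (intro ell2.span_sum)
    then show "x \<in> coord_subspace I"
      unfolding coord_subspace_def closure_sequential
      by (intro CollectI exI[of _ "\<lambda>k. \<Sum>i<k. ell2_scale (seq x i) (ell2_unit i)"] conjI allI
          truncation_tendsto)
  qed
qed

lemma closed_coord_subspace: "closed (coord_subspace I)"
  by (simp add: coord_subspace_def)

lemma subspace_coord_subspace: "ell2.subspace (coord_subspace I)"
  by (auto simp: coord_subspace_eq ell2.subspace_def zero_ell2.rep_eq plus_ell2.rep_eq
      ell2_scale.rep_eq)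

section \<open>Synthesis and analysis operators of a frame\<close>

locale frame_synthesis = hilbert_space smul ip
  for smul :: "'k::real_or_complex \<Rightarrow> 'h::banach \<Rightarrow> 'h" and ip +
  fixes f :: "nat \<Rightarrow> 'h" and T :: "'k ell2 \<Rightarrow> 'h"
  assumes frame: "is_frame ip UNIV f UNIV"
    and synthesis: "synthesis_operator smul f T"
begin

lemma bounded_linear_T: "bounded_linear T"
  and T_scale: "T (ell2_scale c x) = smul c (T x)"
  and T_unit: "T (ell2_unit n) = f n"
  using synthesis by (auto simp: synthesis_operator_def)

lemmas linear_T = bounded_linear.linear[OF bounded_linear_T]

lemmas T_add = linear_add[OF linear_T]
  and T_diff = linear_diff[OF linear_T]
  and T_zero = linear_0[OF linear_T]
  and T_sum = linear_sum[OF linear_T]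

lemma T_tendsto: "(\<lambda>k. \<Sum>i<k. smul (seq y i) (f i)) \<longlonglongrightarrow> T y"
  using bounded_linear.tendsto[OF bounded_linear_T truncation_tendsto[of y]]
  by (simp add: T_sum T_scale T_unit)

lemma subspace_nullspace: "ell2.subspace (nullspace T)"
  by (simp add: ell2.subspace_def nullspace_def T_zero T_add T_scale)

lemma closed_nullspace: "closed (nullspace T)"
  unfolding nullspace_def
  by (intro closed_Collect_eq continuous_intros bounded_linear.continuous_on[OF bounded_linear_T])

lemma span_subset_T_image: "span (f ` I) \<subseteq> T ` coord_subspace I"
proof (rule span_minimal)
  show "f ` I \<subseteq> T ` coord_subspace I"
  proof
    fix v assume "v \<in> f ` I"
    then obtain i where "i \<in> I" "v = T (ell2_unit i)" by (auto simp: T_unit)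
    then show "v \<in> T ` coord_subspace I"
      by (auto simp: coord_subspace_eq ell2_unit.rep_eq)
  qed
  show "subspace (T ` coord_subspace I)"
  proof (rule subspaceI)
    show "0 \<in> T ` coord_subspace I"
      using subspace_coord_subspace T_zero ell2.subspace_0 by (metis image_eqI)
    show "x + y \<in> T ` coord_subspace I"
      if "x \<in> T ` coord_subspace I" "y \<in> T ` coord_subspace I" for x y
      using that subspace_coord_subspace by (auto simp: T_add[symmetric] intro!: imageI ell2.subspace_add)
    show "smul c x \<in> T ` coord_subspace I" if "x \<in> T ` coord_subspace I" for c x
      using that subspace_coord_subspace by (auto simp: T_scale[symmetric] intro!: imageI ell2.subspace_scale)
  qed
qed

lemma T_in_closure_span:
  assumes "y \<in> coord_subspace I"
  shows "T y \<in> closure (span (f ` I))"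
proof -
  have "smul (seq y i) (f i) \<in> span (f ` I)" for i
  proof (cases "i \<in> I")
    case True
    then show ?thesis by (intro span_scale span_base) auto
  next
    case False
    then have "seq y i = 0" using assms by (simp add: coord_subspace_eq)
    then show ?thesis by (simp add: span_zero)
  qed
  then have "(\<Sum>i<k. smul (seq y i) (f i)) \<in> span (f ` I)" for k by (intro span_sum)
  then show ?thesis
    unfolding closure_sequential
    by (intro CollectI exI[of _ "\<lambda>k. \<Sum>i<k. smul (seq y i) (f i)"] conjI allI T_tendsto)
qed

definition analysis :: "nat set \<Rightarrow> 'h \<Rightarrow> 'k ell2" where
  "analysis I g = Abs_ell2 (\<lambda>n. if n \<in> I then ip g (f n) else 0)"

lemma summable_coeffs: "summable (\<lambda>n. (norm (ip g (f n)))\<^sup>2)"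
  using frame summable_on_UNIV_nonneg_real_iff[of "\<lambda>n. (norm (ip g (f n)))\<^sup>2"]
  by (auto simp: is_frame_def frame_with_bounds_def)

lemma seq_analysis: "seq (analysis I g) n = (if n \<in> I then ip g (f n) else 0)"
proof -
  have "summable (\<lambda>n. (norm (if n \<in> I then ip g (f n) else 0))\<^sup>2)"
    by (rule summable_comparison_test'[OF summable_coeffs[of g]]) auto
  then show ?thesis by (simp add: analysis_def Abs_ell2_inverse)
qed

lemma analysis_mem: "analysis I g \<in> coord_subspace I"
  by (simp add: coord_subspace_eq seq_analysis)

lemma coeffs_has_sum:
  "((\<lambda>n. (norm (ip g (f n)))\<^sup>2) has_sum (norm (analysis I g))\<^sup>2) I"
proof -
  let ?F = "\<lambda>n. (norm (seq (analysis I g) n))\<^sup>2"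
  have "(?F has_sum (norm (analysis I g))\<^sup>2) UNIV"
    unfolding norm_ell2_sq
    by (rule norm_summable_imp_has_sum)
       (simp_all add: summable_seq summable_sums)
  then show ?thesis
    by (rule has_sum_cong_neutral[THEN iffD1, rotated -1]) (auto simp: seq_analysis)
qed

lemma norm_analysis_mono: "I \<subseteq> J \<Longrightarrow> norm (analysis I g) \<le> norm (analysis J g)"
  by (rule power2_le_imp_le, unfold norm_ell2_sq, rule suminf_le[OF _ summable_seq summable_seq])
     (auto simp: seq_analysis)

lemma analysis_bound:
  obtains B where "B > 0" "\<And>I g. (norm (analysis I g))\<^sup>2 \<le> B * (norm g)\<^sup>2"
proof -
  obtain A B where AB: "frame_with_bounds ip UNIV f UNIV A B" using frame is_frame_def by blast
  have "(norm (analysis I g))\<^sup>2 \<le> B * (norm g)\<^sup>2" for I g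
  proof -
    have "(norm (analysis I g))\<^sup>2 \<le> (norm (analysis UNIV g))\<^sup>2"
      by (simp add: norm_analysis_mono power_mono)
    also have "\<dots> \<le> B * (norm g)\<^sup>2"
      using AB unfolding infsumI[OF coeffs_has_sum[of g UNIV], symmetric]
      by (auto simp: frame_with_bounds_def)
    finally show ?thesis .
  qed
  with AB that show ?thesis by (auto simp: frame_with_bounds_def)
qed

lemma analysis_add: "analysis I (g + h) = analysis I g + analysis I h"
  by (rule ell2_eqI) (simp add: seq_analysis plus_ell2.rep_eq ip_add_left)

lemma analysis_smul: "analysis I (smul c g) = ell2_scale c (analysis I g)"
  by (rule ell2_eqI) (simp add: seq_analysis ell2_scale.rep_eq ip_smul_left)

lemma bounded_linear_analysis: "bounded_linear (analysis I)"
proof -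
  obtain B where B: "B > 0" "\<And>I g. (norm (analysis I g))\<^sup>2 \<le> B * (norm g)\<^sup>2"
    using analysis_bound by blast
  show ?thesis
  proof (rule bounded_linear_intro)
    show "analysis I (r *\<^sub>R g) = r *\<^sub>R analysis I g" for r g
      using analysis_smul[of I "of_real r" g] by (simp add: smul_of_real ell2.smul_of_real)
    show "norm (analysis I g) \<le> norm g * sqrt B" for g
      by (rule power2_le_imp_le) (use B in \<open>simp_all add: power_mult_distrib mult.commute\<close>)
  qed (rule analysis_add)
qed

text \<open>
  This is the adjointness of analysis and synthesis: expanding \<open>T y\<close> into the vectors \<open>f n\<close> turns
  one inner product into the other.
\<close>

lemma ip_T:
  assumes "y \<in> coord_subspace I"
  shows "ip (T y) g = ell2_inner y (analysis I g)"
proof (rule LIMSEQ_unique)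
  have lin: "ip (\<Sum>i<k. smul (seq y i) (f i)) g = (\<Sum>i<k. seq y i * ip (f i) g)" for k
    using linear_sum[OF bounded_linear.linear[OF bounded_linear_ip_left[of g]]]
    by (metis (no_types, lifting) ip_smul_left sum.cong)
  show "(\<lambda>k. \<Sum>i<k. seq y i * ip (f i) g) \<longlonglongrightarrow> ip (T y) g"
    using bounded_linear.tendsto[OF bounded_linear_ip_left[of g] T_tendsto[of y]] unfolding lin .
  have eq: "seq y i * conj (seq (analysis I g) i) = seq y i * ip (f i) g" for i
  proof (cases "i \<in> I")
    case True
    then show ?thesis using ip_commute[of "f i" g] by (simp add: seq_analysis)
  next
    case False
    then show ?thesis using assms by (simp add: coord_subspace_eq)
  qed
  show "(\<lambda>k. \<Sum>i<k. seq y i * ip (f i) g) \<longlonglongrightarrow> ell2_inner y (analysis I g)"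
    using summable_LIMSEQ[OF summable_ell2_inner[of y "analysis I g"]]
    unfolding ell2_inner.rep_eq eq .
qed

text \<open>
  For finite \<open>J\<close>, the elements of the coordinate subspace are the coefficient families on \<open>J\<close>, and
  \<open>T\<close> maps each of them to the corresponding linear combination.
\<close>

lemma indep_family_iff_nullspace:
  assumes "finite J"
  shows "indep_family smul f J \<longleftrightarrow> nullspace T \<inter> coord_subspace J = {0}"
proof -
  define comb :: "(nat \<Rightarrow> 'k) \<Rightarrow> 'k ell2" where "comb c = (\<Sum>i\<in>J. ell2_scale (c i) (ell2_unit i))" for c
  have seq_comb: "seq (comb c) n = (if n \<in> J then c n else 0)" for c n
    using assms
    by (simp add: comb_def seq_sum ell2_scale.rep_eq ell2_unit.rep_eq if_distrib cong: if_cong)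
  have T_comb: "T (comb c) = (\<Sum>i\<in>J. smul (c i) (f i))" for c
    by (simp add: comb_def T_sum T_scale T_unit)
  have M: "coord_subspace J = range comb"
  proof (intro equalityI subsetI)
    fix y :: "'k ell2" assume "y \<in> coord_subspace J"
    then have "y = comb (seq y)"
      by (intro ell2_eqI) (simp add: seq_comb coord_subspace_eq)
    then show "y \<in> range comb" by blast
  qed (auto simp: coord_subspace_eq seq_comb)
  have comb_0: "comb c = 0 \<longleftrightarrow> (\<forall>i\<in>J. c i = 0)" for c
    by (auto simp: seq_inject[symmetric] fun_eq_iff seq_comb zero_ell2.rep_eq)
  have "nullspace T \<inter> coord_subspace J = {0} \<longleftrightarrow> (\<forall>y\<in>coord_subspace J. T y = 0 \<longrightarrow> y = 0)"
    using T_zero ell2.subspace_0[OF subspace_coord_subspace] by (auto simp: nullspace_def)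
  also have "\<dots> \<longleftrightarrow> (\<forall>c. T (comb c) = 0 \<longrightarrow> comb c = 0)" by (simp add: M)
  finally show ?thesis unfolding T_comb comb_0 indep_family_iff[OF assms] ..
qed

text \<open>
  The lower frame inequality, required on the span only. By continuity it then extends to the closed
  span, so that the same predicate serves for finite subfamilies and for Riesz frames.
\<close>

definition lower_bound_on :: "nat set \<Rightarrow> real \<Rightarrow> bool" where
  "lower_bound_on I A \<longleftrightarrow> (\<forall>g\<in>span (f ` I). A * (norm g)\<^sup>2 \<le> (norm (analysis I g))\<^sup>2)"

text \<open>
  This bounds from below the reduced minimum modulus of the restriction of \<open>T\<close> to the coordinate
  subspace, whose kernel is the intersection with the null space of \<open>T\<close>.
\<close>

definition coercive_on :: "nat set \<Rightarrow> real \<Rightarrow> bool" where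
  "coercive_on I d \<longleftrightarrow>
     (\<forall>y \<in> coord_subspace I \<inter> ortho ell2_inner (nullspace T \<inter> coord_subspace I).
        d * norm y \<le> norm (T y))"

lemma lower_bound_on_closure:
  assumes "lower_bound_on I A" "g \<in> closure (span (f ` I))"
  shows "A * (norm g)\<^sup>2 \<le> (norm (analysis I g))\<^sup>2"
proof -
  have "closed {g. A * (norm g)\<^sup>2 \<le> (norm (analysis I g))\<^sup>2}"
    by (intro closed_Collect_le continuous_intros
        bounded_linear.continuous_on[OF bounded_linear_analysis])
  then have "closure (span (f ` I)) \<subseteq> {g. A * (norm g)\<^sup>2 \<le> (norm (analysis I g))\<^sup>2}"
    using assms(1) by (intro closure_minimal) (auto simp: lower_bound_on_def)
  with assms(2) show ?thesis by blast
qed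

section \<open>Riesz frames and finite independent subfamilies\<close>

lemma frame_with_bounds_iff:
  assumes "f ` I \<subseteq> K" "B > 0" "\<And>I g. (norm (analysis I g))\<^sup>2 \<le> B * (norm g)\<^sup>2"
  shows "frame_with_bounds ip K f I A B \<longleftrightarrow>
    A > 0 \<and> (\<forall>g\<in>K. A * (norm g)\<^sup>2 \<le> (norm (analysis I g))\<^sup>2)"
proof -
  have "(\<lambda>n. (norm (ip g (f n)))\<^sup>2) summable_on I"
    and "(\<Sum>\<^sub>\<infinity>n\<in>I. (norm (ip g (f n)))\<^sup>2) = (norm (analysis I g))\<^sup>2" for g
    using coeffs_has_sum[of g I] by (auto simp: infsumI summable_on_def)
  then show ?thesis using assms by (auto simp: frame_with_bounds_def)
qed

lemma frame_with_bounds_imp: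
  assumes "frame_with_bounds ip K f I A B" "span (f ` I) \<subseteq> K"
  shows "lower_bound_on I A"
  using assms unfolding lower_bound_on_def infsumI[OF coeffs_has_sum, symmetric]
  by (auto simp: frame_with_bounds_def)

lemma riesz_frame_iff: "riesz_frame smul ip f \<longleftrightarrow> (\<exists>A>0. \<forall>I. lower_bound_on I A)"
proof
  assume "riesz_frame smul ip f"
  then obtain A B where "A > 0" "\<And>I. frame_with_bounds ip (closure (span (f ` I))) f I A B"
    by (auto simp: riesz_frame_def)
  then show "\<exists>A>0. \<forall>I. lower_bound_on I A"
    using frame_with_bounds_imp closure_subset by blast
next
  assume "\<exists>A>0. \<forall>I. lower_bound_on I A"
  then obtain A where A: "A > 0" "\<And>I. lower_bound_on I A" by blast
  obtain B where B: "B > 0" "\<And>I g. (norm (analysis I g))\<^sup>2 \<le> B * (norm g)\<^sup>2"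
    using analysis_bound by blast
  have "frame_with_bounds ip (closure (span (f ` I))) f I A B" for I
    unfolding frame_with_bounds_iff[OF subset_trans[OF span_superset closure_subset] B]
    using A lower_bound_on_closure by simp
  with A(1) B(1) frame show "riesz_frame smul ip f" unfolding riesz_frame_def by blast
qed

lemma lower_frame_bound_iff:
  "lower_frame_bound ip (span (f ` J)) f J A \<longleftrightarrow> A > 0 \<and> lower_bound_on J A"
proof
  assume "lower_frame_bound ip (span (f ` J)) f J A"
  then show "A > 0 \<and> lower_bound_on J A"
    using frame_with_bounds_imp by (auto simp: lower_frame_bound_def frame_with_bounds_def)
next
  assume A: "A > 0 \<and> lower_bound_on J A"
  obtain B where B: "B > 0" "\<And>I g. (norm (analysis I g))\<^sup>2 \<le> B * (norm g)\<^sup>2"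
    using analysis_bound by blast
  have "frame_with_bounds ip (span (f ` J)) f J A B"
    using A frame_with_bounds_iff[OF span_superset B] by (simp add: lower_bound_on_def)
  then show "lower_frame_bound ip (span (f ` J)) f J A" by (auto simp: lower_frame_bound_def)
qed

text \<open>
  A vector in the span of \<open>f ` I\<close> is a combination of finitely many vectors of a basis contained in
  \<open>f ` I\<close>. Passing to the indices \<open>J\<close> of these vectors drops terms from the frame sum but does not
  change the vector, so the inequality for \<open>J\<close> is the stronger one.
\<close>

lemma lower_bound_on_from_finite:
  assumes "\<And>J. finite J \<Longrightarrow> indep_family smul f J \<Longrightarrow> lower_bound_on J A"
  shows "lower_bound_on I A"
  unfolding lower_bound_on_def
proof
  fix g assume g: "g \<in> span (f ` I)"
  obtain S where S: "S \<subseteq> f ` I" "\<not> dependent S" "f ` I \<subseteq> span S"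
    using maximal_independent_subset by blast
  have "g \<in> span S" using g S(3) span_minimal subspace_span by blast
  then obtain S' c where S': "finite S'" "S' \<subseteq> S" and comb: "g = (\<Sum>v\<in>S'. smul (c v) v)"
    unfolding span_explicit by auto
  have g': "g \<in> span S'" unfolding comb by (intro span_sum span_scale span_base)
  have "S' \<subseteq> f ` I" using S' S(1) by simp
  then obtain J where J: "J \<subseteq> I" "inj_on f J" "S' = f ` J"
    unfolding subset_image_inj by blast
  have "finite J" using J S' by (simp add: finite_image_iff)
  moreover have "indep_family smul f J"
    using J(2,3) independent_mono[OF S(2) S'(2)] by (simp add: indep_family_def)
  ultimately have "A * (norm g)\<^sup>2 \<le> (norm (analysis J g))\<^sup>2"
    using assms[of J] g' J(3) by (simp add: lower_bound_on_def)
  also have "\<dots> \<le> (norm (analysis I g))\<^sup>2"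
    using J by (simp add: norm_analysis_mono power_mono)
  finally show "A * (norm g)\<^sup>2 \<le> (norm (analysis I g))\<^sup>2" .
qed

section \<open>Duality between analysis and synthesis\<close>

text \<open>
  The analysis operator is bounded below on the closed span, so its range \<open>R\<close> there is closed.
  Every vector of the coordinate subspace that is orthogonal to \<open>R\<close> lies in the null space of \<open>T\<close>.
  Hence a vector \<open>y\<close> of the coordinate subspace that is orthogonal to its intersection with the null
  space has the form \<open>analysis I g\<close>, and the squared norm of \<open>y\<close> is the inner product of \<open>T y\<close>
  and \<open>g\<close>.
\<close>

lemma lower_bound_on_imp_coercive_on:
  assumes A: "A > 0" and lower: "lower_bound_on I A"
  shows "coercive_on I (sqrt A)"
  unfolding coercive_on_def
proof
  let ?M = "coord_subspace I :: 'k ell2 set" and ?K = "closure (span (f ` I))"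
  let ?R = "analysis I ` ?K"
  fix y assume y: "y \<in> ?M \<inter> ortho ell2_inner (nullspace T \<inter> ?M)"
  have below: "sqrt A * norm g \<le> norm (analysis I g)" if "g \<in> ?K" for g
  proof (rule power2_le_imp_le)
    show "(sqrt A * norm g)\<^sup>2 \<le> (norm (analysis I g))\<^sup>2"
      using lower_bound_on_closure[OF lower that] A by (simp add: power_mult_distrib)
  qed simp
  have sub: "subspace ?K" by (rule subspace_closure) simp
  have "complete ?R"
  proof (rule complete_isometric_image)
    show "0 < sqrt A" using A by simp
    show "real_vector.subspace ?K"
      using sub subspace_scaleR[OF sub]
      by (simp add: real_vector.subspace_def subspace_add subspace_0)
    show "\<forall>g\<in>?K. sqrt A * norm g \<le> norm (analysis I g)" using below by blast
    show "complete ?K" by (simp add: complete_eq_closed)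
  qed (rule bounded_linear_analysis)
  then have R: "closed ?R" by (rule complete_imp_closed)
  have R': "ell2.subspace ?R"
  proof (rule ell2.subspaceI)
    have "analysis I 0 = 0" by (rule linear_0[OF bounded_linear.linear[OF bounded_linear_analysis]])
    then show "0 \<in> ?R" using subspace_0[OF sub] by (metis image_eqI)
    show "u + v \<in> ?R" if "u \<in> ?R" "v \<in> ?R" for u v
      using that sub by (auto simp: analysis_add[symmetric] intro!: imageI subspace_add)
    show "ell2_scale c u \<in> ?R" if "u \<in> ?R" for c u
      using that sub by (auto simp: analysis_smul[symmetric] intro!: imageI subspace_scale)
  qed
  obtain p where p: "p \<in> ?R" "y - p \<in> ortho ell2_inner ?R"
    using ell2.projection_exists[OF R' R] by blast
  then obtain g where g: "g \<in> ?K" "p = analysis I g" by blast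
  have z: "y - p \<in> ?M"
    using y g analysis_mem ell2.subspace_diff[OF subspace_coord_subspace] by blast
  (* By adjointness, this is the inner product of y - p, which is orthogonal to ?R, with an element
     of ?R. *)
  have "ip (T (y - p)) (T (y - p)) = 0"
    using p(2) T_in_closure_span[OF z] by (subst ip_T[OF z]) (auto simp: ortho_def)
  then have zN: "y - p \<in> nullspace T \<inter> ?M" using z by (simp add: ip_self nullspace_def)
  have "ell2_inner (y - p) y = 0"
    using y zN ell2.ip_eq_0_commute by (auto simp: ortho_def)
  moreover have "ell2_inner (y - p) p = 0" using p by (auto simp: ortho_def)
  ultimately have "ell2_inner (y - p) (y - p) = 0" by (simp add: ell2.ip_diff_right)
  then have yg: "y = analysis I g" using g by (simp add: ell2.ip_self)
  have "(norm y)\<^sup>2 = norm (ell2_inner y (analysis I g))"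
    using yg by (simp add: ell2.norm_ip_self)
  also have "\<dots> = norm (ip (T y) g)" using y by (simp add: ip_T[of y I])
  also have "\<dots> \<le> norm (T y) * norm g" by (rule cauchy_schwarz)
  finally have "sqrt A * (norm y)\<^sup>2 \<le> norm (T y) * (sqrt A * norm g)"
    using A by (simp add: mult.left_commute mult_left_mono)
  also have "\<dots> \<le> norm (T y) * norm y" using below[OF g(1)] yg by (intro mult_left_mono) auto
  finally have "sqrt A * norm y * norm y \<le> norm (T y) * norm y"
    by (simp add: power2_eq_square mult.assoc)
  then show "sqrt A * norm y \<le> norm (T y)"
    by (cases "y = 0") auto
qed

text \<open>
  A vector \<open>g\<close> in the span has a preimage in the coordinate subspace; removing the part of it in the
  null space leaves a preimage of norm at most \<open>norm g / d\<close>. Its inner product with the analysis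
  sequence of \<open>g\<close> is the squared norm of \<open>g\<close>.
\<close>

lemma coercive_on_imp_lower_bound_on:
  assumes d: "d > 0" and coercive: "coercive_on I d"
  shows "lower_bound_on I (d\<^sup>2)"
  unfolding lower_bound_on_def
proof
  let ?M = "coord_subspace I :: 'k ell2 set"
  fix g assume "g \<in> span (f ` I)"
  then obtain y where y: "y \<in> ?M" "T y = g" using span_subset_T_image by blast
  have "ell2.subspace (nullspace T \<inter> ?M)"
    by (rule ell2.subspace_inter[OF subspace_nullspace subspace_coord_subspace])
  moreover have "closed (nullspace T \<inter> ?M)"
    by (rule closed_Int[OF closed_nullspace closed_coord_subspace])
  ultimately obtain p where p: "p \<in> nullspace T \<inter> ?M" "y - p \<in> ortho ell2_inner (nullspace T \<inter> ?M)"
    using ell2.projection_exists by blast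
  have z: "y - p \<in> ?M" using y p ell2.subspace_diff[OF subspace_coord_subspace] by blast
  have Tz: "T (y - p) = g" using p y by (simp add: T_diff nullspace_def)
  have dz: "d * norm (y - p) \<le> norm g"
    using coercive z p(2) Tz unfolding coercive_on_def by (metis IntI)
  have "(norm g)\<^sup>2 = norm (ell2_inner (y - p) (analysis I g))"
    using ip_T[OF z, of g] Tz by (metis norm_ip_self)
  also have "\<dots> \<le> norm (y - p) * norm (analysis I g)" by (rule ell2.cauchy_schwarz)
  finally have "d * (norm g)\<^sup>2 \<le> (d * norm (y - p)) * norm (analysis I g)"
    using d by (simp add: mult.assoc mult_left_mono)
  also have "\<dots> \<le> norm g * norm (analysis I g)" using dz by (rule mult_right_mono) simp
  finally have "d * norm g * norm g \<le> norm (analysis I g) * norm g"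
    by (simp add: power2_eq_square mult_ac)
  then have "d * norm g \<le> norm (analysis I g)" by (cases "g = 0") auto
  then have "(d * norm g)\<^sup>2 \<le> (norm (analysis I g))\<^sup>2" using d by (intro power_mono) auto
  then show "d\<^sup>2 * (norm g)\<^sup>2 \<le> (norm (analysis I g))\<^sup>2" by (simp add: power_mult_distrib)
qed

lemma uniform_bounds_iff:
  "(\<exists>A>0. \<forall>I. P I \<longrightarrow> lower_bound_on I A) \<longleftrightarrow> (\<exists>d>0. \<forall>I. P I \<longrightarrow> coercive_on I d)"
  using lower_bound_on_imp_coercive_on coercive_on_imp_lower_bound_on
  by (metis real_sqrt_gt_0_iff zero_less_power)

text \<open>
  This is the passage from a lower frame bound to coercivity for the whole frame, as the coordinate
  subspace of all indices is the whole space.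
\<close>

lemma coercive_on_nullspace_complement:
  obtains d where "d > 0" "\<And>z. z \<in> ortho ell2_inner (nullspace T) \<Longrightarrow> d * norm z \<le> norm (T z)"
proof -
  obtain A B where AB: "frame_with_bounds ip UNIV f UNIV A B" using frame is_frame_def by blast
  then have "A > 0" "lower_bound_on UNIV A"
    using frame_with_bounds_imp[OF AB] by (auto simp: frame_with_bounds_def)
  then have "coercive_on UNIV (sqrt A)" by (rule lower_bound_on_imp_coercive_on)
  then have "\<And>z. z \<in> ortho ell2_inner (nullspace T) \<Longrightarrow> sqrt A * norm z \<le> norm (T z)"
    by (simp add: coercive_on_def coord_subspace_eq)
  moreover have "sqrt A > 0" using \<open>A > 0\<close> by simp
  ultimately show ?thesis using that by blast
qed

section \<open>Angles between the null space and coordinate subspaces\<close>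

text \<open>
  Removing from a unit vector \<open>y\<close> its component along \<open>x \<in> N\<close> does not change \<open>T y\<close>. As \<open>T\<close> has
  bound \<open>K\<close>, what remains of \<open>y\<close> has norm at least \<open>d / K\<close>, so the component has norm at most
  \<open>sqrt (1 - (d / K)\<^sup>2)\<close>. The maximum with \<open>0\<close> covers the case where there are no unit vectors to
  compare and \<open>d\<close> may exceed \<open>K\<close>.
\<close>

lemma angle_cos_le:
  assumes d: "d > 0" and coercive: "coercive_on I d"
    and K: "K > 0" "\<And>x. norm (T x) \<le> norm x * K"
  shows "angle_cos ell2_inner (nullspace T) (coord_subspace I) \<le> sqrt (max 0 (1 - (d / K)\<^sup>2))"
proof -
  let ?M = "coord_subspace I :: 'k ell2 set" and ?N = "nullspace T"
  have "norm (ell2_inner x y) \<le> sqrt (max 0 (1 - (d / K)\<^sup>2))"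
    if x: "x \<in> ?N" "norm x = 1" and y: "y \<in> ?M \<inter> ortho ell2_inner (?N \<inter> ?M)" "norm y = 1" for x y
  proof -
    define z where "z = y - ell2_scale (ell2_inner y x) x"
    have "T z = T y" using x by (simp add: z_def T_diff T_scale nullspace_def)
    have "d * norm y \<le> norm (T y)" using coercive y(1) unfolding coercive_on_def by blast
    also have "\<dots> \<le> norm z * K" using K(2)[of z] \<open>T z = T y\<close> by simp
    finally have "d \<le> norm z * K" using y(2) by simp
    then have "(d / K)\<^sup>2 \<le> (norm z)\<^sup>2" using d K by (intro power_mono) (auto simp: divide_le_eq)
    also have "\<dots> = 1 - (norm (ell2_inner y x))\<^sup>2"
      unfolding z_def using ell2.norm_reject_unit_sq[OF x(2), of y] y(2) by simp
    finally have "(norm (ell2_inner x y))\<^sup>2 \<le> max 0 (1 - (d / K)\<^sup>2)"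
      by (simp add: ell2.norm_ip_commute[of x y])
    then show ?thesis by (rule real_le_rsqrt)
  qed
  then show ?thesis
    unfolding angle_cos_def Let_def by (auto intro!: cSup_least)
qed

lemma angle_cos_le_1: "angle_cos ell2_inner M (M' :: 'k ell2 set) \<le> 1"
proof -
  have "norm (ell2_inner x y) \<le> 1" if "norm x = 1" "norm y = 1" for x y :: "'k ell2"
    using ell2.cauchy_schwarz[of x y] that by simp
  then show ?thesis unfolding angle_cos_def Let_def by (auto intro!: cSup_least)
qed

lemma norm_inner_le_angle_cos:
  fixes x y :: "'k ell2"
  assumes "x \<in> M \<inter> ortho ell2_inner (M \<inter> M')" "y \<in> M' \<inter> ortho ell2_inner (M \<inter> M')"
    and "norm x = 1" "norm y = 1"
  shows "norm (ell2_inner x y) \<le> angle_cos ell2_inner M M'"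
proof -
  let ?S = "{norm (ell2_inner x y) | x y. x \<in> M \<inter> ortho ell2_inner (M \<inter> M') \<and>
    y \<in> M' \<inter> ortho ell2_inner (M \<inter> M') \<and> norm x = 1 \<and> norm y = 1}"
  have mem: "norm (ell2_inner x y) \<in> ?S" using assms by blast
  have "bdd_above ?S"
  proof (rule bdd_aboveI[of _ 1])
    fix r assume "r \<in> ?S"
    then obtain x y :: "'k ell2" where "r = norm (ell2_inner x y)" "norm x = 1" "norm y = 1" by blast
    then show "r \<le> 1" using ell2.cauchy_schwarz[of x y] by simp
  qed
  with mem have "norm (ell2_inner x y) \<le> Sup ?S" by (rule cSup_upper)
  moreover have "?S \<noteq> {}" using mem by blast
  ultimately show ?thesis unfolding angle_cos_def Let_def by (simp only: if_False)
qed

text \<open>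
  One direction is the bound on the angle above. Conversely, if \<open>p\<close> is the projection of \<open>y\<close> to \<open>N\<close>,
  then \<open>T y = T (y - p)\<close>, and \<open>T\<close> is bounded below on the complement of \<open>N\<close>. The angle condition
  limits the norm of \<open>p\<close> to a fraction \<open>c < 1\<close> of that of \<open>y\<close>, so Pythagoras bounds the norm of
  \<open>y - p\<close> from below.
\<close>

lemma basis_compatible_iff: "basis_compatible (nullspace T) \<longleftrightarrow> (\<exists>d>0. \<forall>I. coercive_on I d)"
proof
  assume "\<exists>d>0. \<forall>I. coercive_on I d"
  then obtain d where d: "d > 0" "\<And>I. coercive_on I d" by blast
  obtain K where K: "K > 0" "\<And>x. norm (T x) \<le> norm x * K"
    using bounded_linear.pos_bounded[OF bounded_linear_T] by blast
  have "(SUP I. angle_cos ell2_inner (nullspace T) (coord_subspace I)) \<le> sqrt (max 0 (1 - (d / K)\<^sup>2))"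
    using angle_cos_le[OF d(1) d(2) K] by (intro cSUP_least) auto
  also have "\<dots> < 1" using d K by simp
  finally show "basis_compatible (nullspace T)" by (simp add: basis_compatible_def)
next
  assume compat: "basis_compatible (nullspace T)"
  let ?N = "nullspace T"
  define c where "c = max 0 (SUP I. angle_cos ell2_inner ?N (coord_subspace I))"
  have c: "0 \<le> c" "c < 1" using compat by (simp_all add: c_def basis_compatible_def)
  have "bdd_above (range (\<lambda>I. angle_cos ell2_inner ?N (coord_subspace I)))"
    using angle_cos_le_1 by (intro bdd_aboveI2[of _ _ 1])
  then have angle: "angle_cos ell2_inner ?N (coord_subspace I) \<le> c" for I
    unfolding c_def by (intro max.coboundedI2 cSUP_upper) auto
  obtain e where e: "e > 0" "\<And>z. z \<in> ortho ell2_inner ?N \<Longrightarrow> e * norm z \<le> norm (T z)"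
    using coercive_on_nullspace_complement by blast
  define d where "d = e * sqrt (1 - c\<^sup>2)"
  have "c\<^sup>2 < 1" using c by (simp add: abs_square_less_1)
  then have "d > 0" using e by (simp add: d_def)
  moreover have "coercive_on I d" for I
    unfolding coercive_on_def
  proof
    let ?M = "coord_subspace I :: 'k ell2 set"
    fix y assume y: "y \<in> ?M \<inter> ortho ell2_inner (?N \<inter> ?M)"
    obtain p where p: "p \<in> ?N" "y - p \<in> ortho ell2_inner ?N"
      using ell2.projection_exists[OF subspace_nullspace closed_nullspace] by blast
    (* The angle only concerns vectors orthogonal to the intersection; p is one, as the
       difference of y and y - p, which are both orthogonal to it. *)
    have "y - p \<in> ortho ell2_inner (?N \<inter> ?M)" using p(2) by (simp add: ortho_def)
    then have "y - (y - p) \<in> ortho ell2_inner (?N \<inter> ?M)"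
      using y ell2.subspace_diff[OF ell2.subspace_ortho] by blast
    then have p': "p \<in> ?N \<inter> ortho ell2_inner (?N \<inter> ?M)" using p(1) by simp
    have orth: "ell2_inner (y - p) p = 0" using p by (simp add: ortho_def)
    have "norm p \<le> c * norm y"
    proof (cases "p = 0 \<or> y = 0")
      case True
      have "p = 0" if "y = 0" using that p ell2.ortho_disjoint[of p ?N]
        ell2.subspace_neg[OF ell2.subspace_ortho, of "- p" ?N] by simp
      with True c show ?thesis by auto
    next
      case False
      let ?u = "(1 / norm p) *\<^sub>R p" and ?v = "(1 / norm y) *\<^sub>R y"
      have "norm (ell2_inner ?u ?v) \<le> angle_cos ell2_inner ?N ?M"
      proof (rule norm_inner_le_angle_cos)
        show "?u \<in> ?N \<inter> ortho ell2_inner (?N \<inter> ?M)"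
          using p' by (intro IntI ell2.subspace_scaleR subspace_nullspace ell2.subspace_ortho) auto
        show "?v \<in> ?M \<inter> ortho ell2_inner (?N \<inter> ?M)"
          using y by (intro IntI ell2.subspace_scaleR subspace_coord_subspace ell2.subspace_ortho) auto
      qed (use False in auto)
      also have "\<dots> \<le> c" by (rule angle)
      finally have "norm (ell2_inner ?u ?v) \<le> c" .
      moreover have "norm (ell2_inner ?u ?v) = norm p / norm y"
      proof -
        have "ell2_inner y p = ell2_inner p p" using orth by (simp add: ell2.ip_diff_left)
        then have "norm (ell2_inner p y) = (norm p)\<^sup>2"
          by (metis ell2.norm_ip_commute ell2.norm_ip_self)
        moreover have "norm (ell2_inner ?u ?v) = norm (ell2_inner p y) / (norm p * norm y)"
          using False ell2.norm_ip_commute[of p ?v] ell2.norm_ip_commute[of p y]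
          by (simp add: ell2.ip_scaleR_left norm_mult norm_divide)
        ultimately show ?thesis using False by (simp add: power2_eq_square)
      qed
      ultimately show ?thesis using False by (simp add: divide_le_eq)
    qed
    then have "(norm p)\<^sup>2 \<le> c\<^sup>2 * (norm y)\<^sup>2"
      using power_mono[of "norm p" "c * norm y" 2] by (simp add: power_mult_distrib)
    then have "(1 - c\<^sup>2) * (norm y)\<^sup>2 \<le> (norm (y - p))\<^sup>2"
      using ell2.pythagoras[OF orth] by (simp add: algebra_simps)
    then have "sqrt ((1 - c\<^sup>2) * (norm y)\<^sup>2) \<le> norm (y - p)"
      by (rule real_le_lsqrt[rotated 1]) simp_all
    then have "d * norm y \<le> e * norm (y - p)"
      using e by (simp add: d_def real_sqrt_mult mult.assoc)
    also have "\<dots> \<le> norm (T (y - p))" using e p by blast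
    also have "T (y - p) = T y" using p by (simp add: T_diff nullspace_def)
    finally show "d * norm y \<le> norm (T y)" .
  qed
  ultimately show "\<exists>d>0. \<forall>I. coercive_on I d" by blast
qed

section \<open>The reduced minimum modulus\<close>

text \<open>
  If \<open>T\<close> is injective on the coordinate subspace \<open>M\<close>, then the null space of \<open>T\<close> composed with the
  projection to \<open>M\<close> is the orthogonal complement of \<open>M\<close>. So the infimum that defines the modulus
  runs over the unit vectors of \<open>M\<close>, where the projection is the identity.
\<close>

lemma reduced_min_modulus_iff:
  assumes inj: "nullspace T \<inter> coord_subspace J = {0}"
  shows "ereal d \<le> reduced_min_modulus ell2_inner (T \<circ> orth_proj ell2_inner (coord_subspace J))
    \<longleftrightarrow> coercive_on J d"
proof -
  let ?M = "coord_subspace J :: 'k ell2 set"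
  let ?P = "orth_proj ell2_inner ?M"
  note M = subspace_coord_subspace[of J] closed_coord_subspace[of J]
  have P: "?P x \<in> ?M" "x - ?P x \<in> ortho ell2_inner ?M" for x
    using ell2.projection_exists[OF M, of x] ell2.orth_proj_eqI[OF M(1), of _ x] by metis+
  have P_id: "?P x = x" if "x \<in> ?M" for x
    using that by (intro ell2.orth_proj_eqI M(1)) (simp_all add: ell2.subspace_0[OF ell2.subspace_ortho])
  have "nullspace (T \<circ> ?P) = ortho ell2_inner ?M"
  proof (intro equalityI subsetI)
    fix x assume "x \<in> nullspace (T \<circ> ?P)"
    then have "?P x \<in> nullspace T \<inter> ?M" using P by (simp add: nullspace_def)
    then show "x \<in> ortho ell2_inner ?M" using P(2)[of x] inj by simp
  next
    fix x assume "x \<in> ortho ell2_inner ?M"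
    then have "?P x = 0"
      by (intro ell2.orth_proj_eqI M(1)) (simp_all add: ell2.subspace_0[OF M(1)])
    then show "x \<in> nullspace (T \<circ> ?P)" by (simp add: nullspace_def T_zero)
  qed
  then have "ortho ell2_inner (nullspace (T \<circ> ?P)) = ?M" using ell2.ortho_ortho[OF M] by simp
  then have "ereal d \<le> reduced_min_modulus ell2_inner (T \<circ> ?P) \<longleftrightarrow>
      (\<forall>x\<in>?M. norm x = 1 \<longrightarrow> d \<le> norm (T x))"
    by (auto simp: reduced_min_modulus_def le_INF_iff P_id)
  also have "\<dots> \<longleftrightarrow> (\<forall>x\<in>?M. d * norm x \<le> norm (T x))"
  proof
    assume unit: "\<forall>x\<in>?M. norm x = 1 \<longrightarrow> d \<le> norm (T x)"
    show "\<forall>x\<in>?M. d * norm x \<le> norm (T x)"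
    proof
      fix x assume x: "x \<in> ?M"
      show "d * norm x \<le> norm (T x)"
      proof (cases "x = 0")
        case False
        have "d \<le> norm (T ((1 / norm x) *\<^sub>R x))"
          using x False by (intro unit[rule_format] ell2.subspace_scaleR[OF M(1)]) simp_all
        then show ?thesis using False by (simp add: linear_scale[OF linear_T] le_divide_eq)
      qed (simp add: T_zero)
    qed
  qed force
  also have "\<dots> \<longleftrightarrow> coercive_on J d" by (simp add: coercive_on_def inj ortho_def)
  finally show ?thesis .
qed

end

section \<open>The equivalence\<close>

theorem theorem3p6:
  fixes smul :: "'k::real_or_complex \<Rightarrow> 'h::banach \<Rightarrow> 'h"
    and ip :: "'h \<Rightarrow> 'h \<Rightarrow> 'k"
    and f :: "nat \<Rightarrow> 'h"
    and T :: "'k ell2 \<Rightarrow> 'h"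
    and N :: "'k ell2 set"
  assumes "hilbert_space smul ip"
    and "separable_space (euclidean :: 'h topology)"
    and "is_frame ip UNIV f UNIV"
    and "synthesis_operator smul f T"
    and "N = nullspace T"
  shows "(riesz_frame smul ip f \<longleftrightarrow> basis_compatible N) \<and>
    (basis_compatible N \<longleftrightarrow>
      (\<exists>A>0. \<forall>J. finite J \<and> indep_family smul f J \<longrightarrow>
         lower_frame_bound ip (kspan smul (f ` J)) f J A)) \<and>
    ((\<exists>A>0. \<forall>J. finite J \<and> indep_family smul f J \<longrightarrow>
         lower_frame_bound ip (kspan smul (f ` J)) f J A) \<longleftrightarrow>
      (\<exists>d>0. \<forall>J. finite J \<and> N \<inter> coord_subspace J = {0} \<longrightarrow>
         reduced_min_modulus ell2_inner (T \<circ> orth_proj ell2_inner (coord_subspace J)) \<ge> ereal d))"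
    (is "(?riesz \<longleftrightarrow> ?compat) \<and> (?compat \<longleftrightarrow> ?fin) \<and> (?fin \<longleftrightarrow> ?modulus)")
proof -
  interpret hilbert_space smul ip by (rule assms(1))
  interpret frame_synthesis smul ip f T
    using assms by unfold_locales
  let ?indep = "\<lambda>J. finite J \<and> indep_family smul f J"
  have "?riesz \<longleftrightarrow> (\<exists>A>0. \<forall>I. True \<longrightarrow> lower_bound_on I A)" by (simp add: riesz_frame_iff)
  also have "\<dots> \<longleftrightarrow> ?compat"
    unfolding uniform_bounds_iff by (simp add: basis_compatible_iff assms(5))
  finally have 12: "?riesz \<longleftrightarrow> ?compat" .
  have fin: "?fin \<longleftrightarrow> (\<exists>A>0. \<forall>J. ?indep J \<longrightarrow> lower_bound_on J A)"
    by (auto simp: lower_frame_bound_iff)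
  also have "\<dots> \<longleftrightarrow> ?riesz"
    unfolding riesz_frame_iff using lower_bound_on_from_finite by blast
  finally have 31: "?fin \<longleftrightarrow> ?riesz" .
  have "?fin \<longleftrightarrow> (\<exists>d>0. \<forall>J. ?indep J \<longrightarrow> coercive_on J d)"
    unfolding fin by (rule uniform_bounds_iff)
  also have "\<dots> \<longleftrightarrow> ?modulus"
    unfolding assms(5)
    by (simp add: indep_family_iff_nullspace reduced_min_modulus_iff cong: conj_cong imp_cong)
  finally show ?thesis using 12 31 by blast
qed

end
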